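(* Let $G$ be an abelian group and let $\{a,b\}$ be a 2-element generating set of $G$. Then the Cayley graph $\operatorname{Cay}\bigl(G; \{\pm a, \pm b\}\bigr)$ is not CCA if and only if $G \cong \mathbb{Z}_4 \times \mathbb{Z}_2$ and $|a| = |b| = 4$.
   Context: Groups are abelian, written additively, and may be infinite; $|a|$ denotes the order of the element $a$, and $\mathbb{Z}_n$ is the cyclic group of order $n$. For a subset $S = -S$ of an abelian group $G$, the Cayley graph $\operatorname{Cay}(G;S)$ is the undirected graph whose vertices are the elements of $G$, with an edge joining $g$ and $g+s$ for all $g \in G$ and $s \in S$. An automorphism $\varphi$ of $\operatorname{Cay}(G;S)$ is colour-preserving if $\varphi(g+s) \in \{\varphi(g) \pm s\}$ for all $g \in G$ and $s \in S$. A bijection $\varphi \colon G \to G$ is affine if there are a group automorphism $\tau$ of $G$ and an element $b_0 \in G$ such that $\varphi(x) = \tau(x) + b_0$ for all $x \in G$. The graph $\operatorname{Cay}(G;S)$ is CCA if every colour-preserving automorphism of it is affine. *)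

theory Defs
  imports "HOL-Algebra.Elementary_Groups" "HOL-Algebra.Multiplicative_Group"
begin

(* HOL-Algebra writes groups multiplicatively: g + s and -s become g \<otimes> s and inv s. *)

(* An undirected graph is a pair of a vertex set and a set of edges, an edge {u, v} being the
   set of its end points; a loop at v is the singleton {v}. *)
type_synonym 'a ugraph = "'a set \<times> 'a set set"

definition cay :: "('a, 'b) monoid_scheme \<Rightarrow> 'a set \<Rightarrow> 'a ugraph" where
  "cay G S = (carrier G, {{g, g \<otimes>\<^bsub>G\<^esub> s} | g s. g \<in> carrier G \<and> s \<in> S})"

(* Maps are total on the type; only their values on the vertex set (the carrier) matter. *)
definition graph_automorphism :: "'a ugraph \<Rightarrow> ('a \<Rightarrow> 'a) \<Rightarrow> bool" where
  "graph_automorphism X \<phi> \<longleftrightarrow>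
     bij_betw \<phi> (fst X) (fst X) \<and>
     (\<forall>u\<in>fst X. \<forall>v\<in>fst X. {u, v} \<in> snd X \<longleftrightarrow> {\<phi> u, \<phi> v} \<in> snd X)"

definition colour_preserving ::
    "('a, 'b) monoid_scheme \<Rightarrow> 'a set \<Rightarrow> ('a \<Rightarrow> 'a) \<Rightarrow> bool" where
  "colour_preserving G S \<phi> \<longleftrightarrow>
     (\<forall>g\<in>carrier G. \<forall>s\<in>S. \<phi> (g \<otimes>\<^bsub>G\<^esub> s) \<in> {\<phi> g \<otimes>\<^bsub>G\<^esub> s, \<phi> g \<otimes>\<^bsub>G\<^esub> inv\<^bsub>G\<^esub> s})"

definition affine_bijection :: "('a, 'b) monoid_scheme \<Rightarrow> ('a \<Rightarrow> 'a) \<Rightarrow> bool" where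
  "affine_bijection G \<phi> \<longleftrightarrow>
     bij_betw \<phi> (carrier G) (carrier G) \<and>
     (\<exists>\<tau>\<in>iso G G. \<exists>b\<^sub>0\<in>carrier G. \<forall>x\<in>carrier G. \<phi> x = \<tau> x \<otimes>\<^bsub>G\<^esub> b\<^sub>0)"

(* The colouring of cay G S depends on G and S, not only on the graph, so CCA is a property of
   the pair; it is meant for S contained in the carrier and closed under inverses. *)
definition cca :: "('a, 'b) monoid_scheme \<Rightarrow> 'a set \<Rightarrow> bool" where
  "cca G S \<longleftrightarrow>
     (\<forall>\<phi>. graph_automorphism (cay G S) \<phi> \<and> colour_preserving G S \<phi> \<longrightarrow> affine_bijection G \<phi>)"

end

theory Submission
  imports Defs
begin

text \<open>Write the difference \<open>\<phi> (g + s) - \<phi> g\<close>, which is \<open>s\<close> or \<open>-s\<close>, as a step. If the steps in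
  directions \<open>a\<close> and \<open>b\<close> do not depend on \<open>g\<close>, then \<open>\<phi>\<close> is affine. A step in direction \<open>s\<close>
  cannot change along \<open>s\<close>; if the one in direction \<open>a\<close> changes between \<open>g\<close> and \<open>g + b\<close>,
  following the two paths from \<open>g\<close> to \<open>g + a + b\<close>, and then those from \<open>g + a\<close>, forces
  \<open>2a = 2b\<close> and \<open>4a = 0\<close> with \<open>2a \<noteq> 0\<close> and \<open>b \<notin> \<langle>a\<rangle>\<close>, so the group is \<open>\<langle>a\<rangle> \<times> \<langle>b - a\<rangle>\<close>. Conversely,
  in \<open>Z\<^sub>4 \<times> Z\<^sub>2\<close> the map that is the identity on \<open>\<langle>a\<rangle>\<close> and \<open>x \<mapsto> 2a - x\<close> elsewhere is a
  colour-preserving automorphism but not affine.\<close>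

definition colour_step :: "('a, 'b) monoid_scheme \<Rightarrow> ('a \<Rightarrow> 'a) \<Rightarrow> 'a \<Rightarrow> 'a \<Rightarrow> 'a" where
  "colour_step G \<phi> s g = inv\<^bsub>G\<^esub> \<phi> g \<otimes>\<^bsub>G\<^esub> \<phi> (g \<otimes>\<^bsub>G\<^esub> s)"

text \<open>An edge may have been recorded from either end; closure under inverses turns one
  recorded at \<open>v\<close> with \<open>s\<close> into one recorded at \<open>u\<close> with
  \<open>inv s\<close>.\<close>

lemma cay_edge_iff:
  fixes G (structure)
  assumes "group G" "S \<subseteq> carrier G" "\<And>s. s \<in> S \<Longrightarrow> inv s \<in> S" "u \<in> carrier G" "v \<in> carrier G"
  shows "{u, v} \<in> snd (cay G S) \<longleftrightarrow> (\<exists>s\<in>S. v = u \<otimes> s)"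
proof -
  interpret group G by fact
  have "\<exists>t\<in>S. v = u \<otimes> t" if "s \<in> S" "u = v \<otimes> s" for s
    using that assms by (intro bexI[of _ "inv s"]) (auto simp: m_assoc subset_iff)
  then show ?thesis
    using assms by (auto simp: cay_def doubleton_eq_iff)
qed

section \<open>Constant steps give affine maps\<close>

context comm_group
begin

text \<open>Additivity in the second argument, for all first arguments at once, passes from
  generators to inverses and sums: for y + z it is used at x and at x + y.\<close>

lemma hom_if_mult_generators:
  assumes "T \<subseteq> carrier G" "generate G T = carrier G" "\<psi> \<in> carrier G \<rightarrow> carrier G"
    and mult: "\<And>x s. x \<in> carrier G \<Longrightarrow> s \<in> T \<Longrightarrow> \<psi> (x \<otimes> s) = \<psi> x \<otimes> \<psi> s"
    and one: "\<psi> \<one> = \<one>"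
  shows "\<psi> \<in> hom G G"
proof -
  have cl: "\<psi> x \<in> carrier G" if "x \<in> carrier G" for x
    using assms that by auto
  have "\<forall>x\<in>carrier G. \<psi> (x \<otimes> y) = \<psi> x \<otimes> \<psi> y" if "y \<in> generate G T" for y
    using that
  proof induction
    case one
    then show ?case using cl by (simp add: \<open>\<psi> \<one> = \<one>\<close>)
  next
    case (incl s)
    then show ?case using mult by blast
  next
    case (inv s)
    then have s: "s \<in> carrier G" using assms by auto
    have *: "\<psi> (x \<otimes> inv s) = \<psi> x \<otimes> inv (\<psi> s)" if x: "x \<in> carrier G" for x
      using mult[of "x \<otimes> inv s" s] inv s x cl by (simp add: m_assoc inv_solve_right)
    show ?case
      using *[of \<one>] * s cl one by simp
  next
    case (eng y z)
    then have "y \<in> carrier G" "z \<in> carrier G" using assms by auto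
    then show ?case using eng cl by (simp add: m_assoc[symmetric])
  qed
  then show ?thesis using assms by (auto simp: hom_def)
qed

text \<open>Translating \<phi> so that the identity is fixed gives \<psi>, whose value at a
  generator s is the step at the identity. Constant steps thus say \<psi>(x + s) = \<psi> x + \<psi>
  s.\<close>

lemma affine_bijection_if_step_const:
  assumes "T \<subseteq> carrier G" "generate G T = carrier G" "bij_betw \<phi> (carrier G) (carrier G)"
    and const: "\<And>s x. s \<in> T \<Longrightarrow> x \<in> carrier G \<Longrightarrow> colour_step G \<phi> s x = colour_step G \<phi> s \<one>"
  shows "affine_bijection G \<phi>"
proof -
  have cl: "\<phi> x \<in> carrier G" if "x \<in> carrier G" for x
    using assms that by (auto simp: bij_betw_def)
  define \<psi> where "\<psi> x = \<phi> x \<otimes> inv (\<phi> \<one>)" for x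
  have "\<psi> (x \<otimes> s) = \<psi> x \<otimes> \<psi> s" if "x \<in> carrier G" "s \<in> T" for x s
  proof -
    have s: "s \<in> carrier G" using that assms by auto
    have "\<phi> (x \<otimes> s) = \<phi> x \<otimes> (inv \<phi> \<one> \<otimes> \<phi> s)"
      using const[OF that(2,1)] s that cl by (simp add: colour_step_def inv_solve_left' m_assoc[symmetric])
    then show ?thesis
      using s that cl by (simp add: \<psi>_def m_ac)
  qed
  then have "\<psi> \<in> hom G G"
    using assms cl by (intro hom_if_mult_generators) (auto simp: \<psi>_def)
  moreover have "bij_betw ((\<lambda>y. y \<otimes> inv \<phi> \<one>) \<circ> \<phi>) (carrier G) (carrier G)"
    using assms(3) by (rule bij_betw_trans)
      (auto intro!: bij_betw_byWitness[where f' = "\<lambda>y. y \<otimes> \<phi> \<one>"] simp: cl m_assoc)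
  ultimately have "\<psi> \<in> iso G G"
    by (simp add: iso_def \<psi>_def[abs_def] comp_def)
  moreover have "\<forall>x\<in>carrier G. \<phi> x = \<psi> x \<otimes> \<phi> \<one>"
    using cl by (simp add: \<psi>_def m_assoc)
  ultimately show ?thesis
    using assms cl unfolding affine_bijection_def by blast
qed

section \<open>Recognising Z_4 x Z_2\<close>

lemma ord_eq_4:
  assumes "x \<in> carrier G" "x \<otimes> x \<noteq> \<one>" "(x \<otimes> x) \<otimes> (x \<otimes> x) = \<one>"
  shows "ord x = 4"
proof -
  have "ord x dvd 4" "\<not> ord x dvd 2"
    using assms by (simp_all flip: pow_eq_id add: numeral_eq_Suc m_assoc)
  moreover have "ord x \<le> 4" using calculation(1) by (intro dvd_imp_le) auto
  then have "ord x = 0 \<or> ord x = 1 \<or> ord x = 2 \<or> ord x = 3 \<or> ord x = 4" by linarith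
  ultimately show ?thesis by (elim disjE) simp_all
qed

text \<open>With c = b - a one has 2c = 0, so (i, j) \<mapsto> ia + jc is defined on Z_4 x Z_2. It
  is injective because c in \<langle>a\<rangle> would put b there too, and surjective because a and
  b are values.\<close>

lemma iso_Z4_Z2:
  assumes a: "a \<in> carrier G" and b: "b \<in> carrier G" and gen: "generate G {a, b} = carrier G"
    and ord: "ord a = 4" and sq: "a \<otimes> a = b \<otimes> b" and notin: "b \<notin> generate G {a}"
  shows "G \<cong> (integer_mod_group 4 \<times>\<times> integer_mod_group 2)"
proof -
  let ?Z = "integer_mod_group 4 \<times>\<times> integer_mod_group 2"
  define c where "c = b \<otimes> inv a"
  have c: "c \<in> carrier G" using a b by (simp add: c_def)
  have "c \<otimes> c = (b \<otimes> b) \<otimes> inv (a \<otimes> a)"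
    using a b by (simp add: c_def inv_mult m_ac)
  then have "c [^] (2::nat) = \<one>"
    using a b by (simp add: sq[symmetric] numeral_eq_Suc c)
  then have ordc: "ord c dvd 2" using c by (simp add: pow_eq_id)
  have ac: "c \<otimes> a = b" using a b by (simp add: c_def m_assoc)
  define h where "h = (\<lambda>(i, j). a [^] (i::int) \<otimes> c [^] (j::int))"
  \<comment> \<open>Addition in \<open>integer_mod_group n\<close> reduces modulo n, so
    \<open>h\<close> is additive once exponents of a may be reduced modulo 4 and those of c modulo
    2.\<close>
  have red_a: "a [^] (k mod 4) = a [^] k" for k :: int
    using a ord by (simp add: int_pow_eq mod_eq_dvd_iff[symmetric])
  have red_c: "c [^] (k mod 2) = c [^] k" for k :: int
  proof -
    have "int (ord c) dvd 2" using ordc by (metis int_dvd_int_iff of_nat_numeral)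
    also have "2 dvd k - k mod 2" by simp
    finally show ?thesis by (simp add: int_pow_eq c)
  qed
  have Z: "group ?Z" by (simp add: DirProd_group)
  have hom: "h \<in> hom ?Z G"
    unfolding hom_def using a c
    by (auto simp: h_def red_a red_c int_pow_mult m_ac)
  then interpret h: group_hom ?Z G h
    using Z by (simp add: group_hom_def group_hom_axioms_def)
  have "inj_on h (carrier ?Z)"
  proof (subst h.inj_on_one_iff, safe)
    fix i j
    assume "(i, j) \<in> carrier ?Z" and one: "h (i, j) = \<one>"
    then have ij: "0 \<le> i" "i < 4" "j = 0 \<or> j = 1"
      by (auto simp: carrier_integer_mod_group)
    from ij(3) show "(i, j) = \<one>\<^bsub>?Z\<^esub>"
    proof
      assume "j = 0"
      then have "a [^] i = \<one>" using one a by (simp add: h_def)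
      then have "4 dvd i" using a ord by (simp add: int_pow_eq_id)
      then show ?thesis using ij \<open>j = 0\<close> by (auto dest: zdvd_imp_le simp: DirProd_def)
    next
      assume "j = 1"
      then have "a [^] i \<otimes> c = \<one>" using one a c by (simp add: h_def int_pow_1)
      then have "c = inv (a [^] i)" using a c by (simp add: inv_equality m_comm)
      then have "c = a [^] (- i)" using a by (simp add: int_pow_neg)
      then have "b = a [^] (- i + 1)"
        using ac a int_pow_mult[OF a, of "- i" 1] by (simp add: int_pow_1)
      then show ?thesis using notin a by (auto simp: generate_pow)
    qed
  qed
  moreover have "h ` carrier ?Z = carrier G"
  proof
    have "subgroup (h ` carrier ?Z) G" by (rule h.img_is_subgroup)
    moreover have "a = h (1, 0)" "b = h (1, 1)"
      using a c ac m_comm[OF a c] by (simp_all add: h_def int_pow_1)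
    then have "{a, b} \<subseteq> h ` carrier ?Z"
      by (auto simp: carrier_integer_mod_group)
    ultimately show "carrier G \<subseteq> h ` carrier ?Z"
      using gen generate_subgroup_incl by metis
  qed auto
  ultimately have "h \<in> iso ?Z G" using hom by (simp add: iso_def bij_betw_def)
  then show ?thesis
    by (rule group.iso_sym[OF Z is_isoI])
qed

section \<open>Where the steps of a colour-preserving bijection can change\<close>

context
  fixes \<phi> :: "'a \<Rightarrow> 'a" and a b :: 'a
  assumes bij: "bij_betw \<phi> (carrier G) (carrier G)"
    and a: "a \<in> carrier G" and b: "b \<in> carrier G"
    and col: "colour_preserving G {a, inv a, b, inv b} \<phi>"
begin

lemma image_closed: "g \<in> carrier G \<Longrightarrow> \<phi> g \<in> carrier G"
  using bij by (auto simp: bij_betw_def)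

lemma colour_step_closed [simp]:
  "\<lbrakk>s \<in> carrier G; g \<in> carrier G\<rbrakk> \<Longrightarrow> colour_step G \<phi> s g \<in> carrier G"
  by (simp add: colour_step_def image_closed)

lemma image_mult:
  "\<lbrakk>s \<in> carrier G; g \<in> carrier G\<rbrakk> \<Longrightarrow> \<phi> (g \<otimes> s) = \<phi> g \<otimes> colour_step G \<phi> s g"
  by (simp add: colour_step_def image_closed m_assoc[symmetric])

lemma colour_step_cases:
  assumes "s \<in> {a, b}" "g \<in> carrier G"
  shows "colour_step G \<phi> s g = s \<or> colour_step G \<phi> s g = inv s"
proof -
  have "s \<in> carrier G" using assms a b by auto
  moreover have "\<phi> (g \<otimes> s) \<in> {\<phi> g \<otimes> s, \<phi> g \<otimes> inv s}"
    using assms col by (auto simp: colour_preserving_def)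
  ultimately show ?thesis
    using assms by (auto simp: colour_step_def image_closed m_assoc[symmetric])
qed

text \<open>A change of direction along a line of one colour would give
  \<open>\<phi> (g + 2s) = \<phi> g\<close>, so \<open>2s = 0\<close> and both directions coincide.\<close>

lemma colour_step_same:
  assumes s: "s \<in> {a, b}" and g: "g \<in> carrier G"
  shows "colour_step G \<phi> s (g \<otimes> s) = colour_step G \<phi> s g"
proof (rule ccontr)
  assume neq: "colour_step G \<phi> s (g \<otimes> s) \<noteq> colour_step G \<phi> s g"
  have sc: "s \<in> carrier G" using s a b by auto
  have "colour_step G \<phi> s g \<otimes> colour_step G \<phi> s (g \<otimes> s) = \<one>"
    using colour_step_cases[OF s g] colour_step_cases[OF s, of "g \<otimes> s"] neq sc g by auto
  moreover have "\<phi> (g \<otimes> s \<otimes> s) = \<phi> g \<otimes> colour_step G \<phi> s g \<otimes> colour_step G \<phi> s (g \<otimes> s)"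
    by (simp only: image_mult sc g m_closed)
  ultimately have "\<phi> (g \<otimes> s \<otimes> s) = \<phi> g"
    using sc g by (simp add: m_assoc[of "\<phi> g"] image_closed)
  then have "g \<otimes> s \<otimes> s = g"
    using bij sc g by (meson bij_betw_def inj_on_def m_closed)
  then have "s \<otimes> s = \<one>" using sc g by (simp add: m_assoc)
  then have "inv s = s" using sc by (simp add: inv_equality)
  then show False
    using colour_step_cases[OF s g] colour_step_cases[OF s, of "g \<otimes> s"] neq sc g by auto
qed

text \<open>Iterates \<open>colour_step_same\<close> forwards and backwards. Its contrapositive
  shows b outside \<langle>a\<rangle> as soon as the step in direction a changes between g and g +
  b.\<close>

lemma colour_step_generate:
  assumes "h \<in> generate G {a}" "g \<in> carrier G"
  shows "colour_step G \<phi> a (g \<otimes> h) = colour_step G \<phi> a g"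
  using assms
proof (induction arbitrary: g)
  case (incl h)
  then show ?case using colour_step_same by simp
next
  case (inv h)
  then show ?case using colour_step_same[of a "g \<otimes> inv a"] a by (simp add: m_assoc)
next
  case (eng h1 h2)
  then have "h1 \<in> carrier G" "h2 \<in> carrier G"
    using a generate_in_carrier[of "{a}"] by auto
  then show ?case using eng by (simp add: m_assoc[symmetric])
qed simp

text \<open>Let z be the step in direction b at g + a. The two paths from g to g + a + b give x + z
  = y - x. As 2x is nonzero, z differs from y, so z = -y and 2x = 2y.\<close>

lemma colour_step_square:
  assumes g: "g \<in> carrier G" and flip: "colour_step G \<phi> a (g \<otimes> b) \<noteq> colour_step G \<phi> a g"
  defines "x \<equiv> colour_step G \<phi> a g" and "y \<equiv> colour_step G \<phi> b g"
  shows "x \<otimes> x = y \<otimes> y" "x \<otimes> x \<noteq> \<one>" "colour_step G \<phi> b (g \<otimes> a) = inv y"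
proof -
  have [simp]: "x \<in> carrier G" "y \<in> carrier G"
    using g a b by (simp_all add: x_def y_def)
  define z where "z = colour_step G \<phi> b (g \<otimes> a)"
  have z: "z \<in> carrier G" using g a b by (simp add: z_def)
  have inv_x: "colour_step G \<phi> a (g \<otimes> b) = inv x"
    using colour_step_cases[of a g] colour_step_cases[of a "g \<otimes> b"] flip a b g
    by (auto simp: x_def)
  have "x \<noteq> inv x" using flip inv_x by (simp add: x_def)
  then show nontriv: "x \<otimes> x \<noteq> \<one>" by (metis \<open>x \<in> carrier G\<close> inv_equality)
  have "\<phi> (g \<otimes> a \<otimes> b) = \<phi> (g \<otimes> b \<otimes> a)" using a b g by (simp add: m_ac)
  moreover have "\<phi> (g \<otimes> a \<otimes> b) = \<phi> g \<otimes> x \<otimes> z"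
    unfolding x_def z_def by (simp only: image_mult a b g m_closed)
  moreover have "\<phi> (g \<otimes> b \<otimes> a) = \<phi> g \<otimes> y \<otimes> inv x"
    unfolding y_def inv_x[symmetric] by (simp only: image_mult a b g m_closed)
  ultimately have "x \<otimes> z = y \<otimes> inv x"
    using image_closed[OF g] z by (simp add: m_assoc)
  then have "x \<otimes> z \<otimes> x = y" using z by (simp add: m_assoc)
  then have xxz: "x \<otimes> x \<otimes> z = y" using z by (simp add: m_ac)
  have "z \<noteq> y"
  proof
    assume "z = y"
    with xxz have "x \<otimes> x \<otimes> y = y" by simp
    then show False using nontriv by simp
  qed
  then have "z = inv y"
    using colour_step_cases[of b g] colour_step_cases[of b "g \<otimes> a"] a b g
    by (auto simp: z_def y_def)
  then show "colour_step G \<phi> b (g \<otimes> a) = inv y" by (simp add: z_def)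
  have "x \<otimes> x = x \<otimes> x \<otimes> inv y \<otimes> y" by (simp add: m_assoc)
  then show "x \<otimes> x = y \<otimes> y" using xxz \<open>z = inv y\<close> by simp
qed

text \<open>If a flip occurs at \<open>g\<close>, another one occurs at \<open>g + a\<close>, where the step in direction \<open>a\<close>
  is the same and the step in direction \<open>b\<close> is reversed; hence \<open>2x = 2y = -2x\<close> for the
  steps \<open>x\<close>, \<open>y\<close> at \<open>g\<close>.\<close>

lemma colour_step_flip:
  assumes g: "g \<in> carrier G" and flip: "colour_step G \<phi> a (g \<otimes> b) \<noteq> colour_step G \<phi> a g"
  shows "a \<otimes> a = b \<otimes> b" "a \<otimes> a \<noteq> \<one>" "(a \<otimes> a) \<otimes> (a \<otimes> a) = \<one>" "b \<notin> generate G {a}"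
proof -
  let ?x = "colour_step G \<phi> a g" and ?y = "colour_step G \<phi> b g"
  have c: "?x \<in> carrier G" "?y \<in> carrier G" using g a b by simp_all
  note sq = colour_step_square[OF g flip]
  have same: "colour_step G \<phi> a (g \<otimes> a) = ?x" by (rule colour_step_same) (use g in auto)
  have "colour_step G \<phi> a (g \<otimes> a \<otimes> b) = colour_step G \<phi> a (g \<otimes> b)"
    using colour_step_same[of a "g \<otimes> b"] a b g by (simp add: m_ac)
  then have "colour_step G \<phi> a (g \<otimes> a \<otimes> b) \<noteq> colour_step G \<phi> a (g \<otimes> a)"
    using flip same by simp
  from colour_step_square(1)[OF _ this] have "?x \<otimes> ?x = inv ?y \<otimes> inv ?y"
    using a g same sq(3) by simp
  then have inv_sq: "inv (?x \<otimes> ?x) = ?x \<otimes> ?x"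
    using sq(1) c by (simp add: inv_mult)
  \<comment> \<open>The steps are the generators only up to sign, but 2x = -2x makes the sign
    irrelevant after doubling.\<close>
  have x: "a \<otimes> a = ?x \<otimes> ?x"
    using colour_step_cases[of a g] g a inv_sq c by (auto simp: inv_mult)
  have y: "b \<otimes> b = ?y \<otimes> ?y"
    using colour_step_cases[of b g] g b inv_sq[unfolded sq(1)] c by (auto simp: inv_mult)
  show "a \<otimes> a = b \<otimes> b" "a \<otimes> a \<noteq> \<one>" using x y sq by simp_all
  show "(a \<otimes> a) \<otimes> (a \<otimes> a) = \<one>" using x inv_sq c r_inv[of "?x \<otimes> ?x"] by simp
  show "b \<notin> generate G {a}" using colour_step_generate[of b g] g flip by auto
qed

end

section \<open>A colour-preserving automorphism that is not affine\<close>

text \<open>On each coset of H = \<langle>a\<rangle> the map \<phi> is the identity or a reflection,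
  so it respects steps in H. A step by b or -b crosses between the two cosets; its image has the
  right colour because 2x is 0 or 2a, and this alternative decides the sign.\<close>

lemma not_cca_if_square_unique:
  assumes a: "a \<in> carrier G" and b: "b \<in> carrier G" and gen: "generate G {a, b} = carrier G"
    and sq: "a \<otimes> a = b \<otimes> b" and nontriv: "a \<otimes> a \<noteq> \<one>" and notin: "b \<notin> generate G {a}"
    and squares: "\<And>x. x \<in> carrier G \<Longrightarrow> x \<otimes> x = \<one> \<or> x \<otimes> x = a \<otimes> a"
  shows "\<not> cca G {a, inv a, b, inv b}"
proof -
  define H where "H = generate G {a}"
  define \<phi> where "\<phi> x = (if x \<in> H then x else a \<otimes> a \<otimes> inv x)" for x
  let ?S = "{a, inv a, b, inv b}"
  have H: "subgroup H G" using a by (simp add: H_def generate_is_subgroup)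
  interpret H: subgroup H G by fact
  have aH: "a \<in> H" by (auto simp: H_def intro: generate.incl)
  have mult_iff: "x \<otimes> h \<in> H \<longleftrightarrow> x \<in> H" if "x \<in> carrier G" "h \<in> H" for x h
  proof
    assume "x \<otimes> h \<in> H"
    then have "x \<otimes> h \<otimes> inv h \<in> H" using that by blast
    then show "x \<in> H" using that by (simp add: m_assoc)
  qed (use that in auto)
  have inv_iff: "inv x \<in> H \<longleftrightarrow> x \<in> H" if "x \<in> carrier G" for x
    using that by (metis H.m_inv_closed inv_inv)
  have bb: "b \<otimes> b \<in> H" using aH by (simp flip: sq)
  \<comment> \<open>H has at most two cosets because 2b = 2a lies in H. The three identities for a
    sum treat both summands outside H, or just one of them.\<close>
  have coset: "x \<in> H \<or> x \<otimes> b \<in> H" if "x \<in> generate G {a, b}" for x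
    using that
  proof induction
    case (incl h)
    then show ?case using aH bb by auto
  next
    case (inv h)
    then show ?case using aH b by auto
  next
    case (eng x y)
    then have c: "x \<in> carrier G" "y \<in> carrier G" using gen by auto
    have "x \<otimes> y \<otimes> (b \<otimes> b) = (x \<otimes> b) \<otimes> (y \<otimes> b)" "x \<otimes> y \<otimes> b = (x \<otimes> b) \<otimes> y"
      "x \<otimes> y \<otimes> b = x \<otimes> (y \<otimes> b)"
      using c b by (simp_all add: m_ac)
    then show ?case using eng(3,4) c bb by (metis H.m_closed mult_iff m_closed)
  qed simp
  have toggle: "x \<otimes> b \<in> H \<longleftrightarrow> x \<notin> H" if x: "x \<in> carrier G" for x
  proof -
    have "x \<otimes> b \<notin> H" if "x \<in> H"
      using mult_iff[of b x] that x b notin by (simp add: m_comm H_def)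
    then show ?thesis using coset x gen by auto
  qed
  have toggle': "x \<otimes> inv b \<in> H \<longleftrightarrow> x \<notin> H" if x: "x \<in> carrier G" for x
    using toggle[of "x \<otimes> inv b"] x b by (auto simp: m_assoc)
  have phi_closed: "\<phi> x \<in> carrier G" if "x \<in> carrier G" for x
    using a that by (simp add: \<phi>_def)
  have twist_iff: "a \<otimes> a \<otimes> inv x \<in> H \<longleftrightarrow> x \<in> H" if "x \<in> carrier G" for x
    using mult_iff[of "inv x" "a \<otimes> a"] a aH that inv_iff by (simp add: m_comm)
  have invol: "\<phi> (\<phi> x) = x" if "x \<in> carrier G" for x
    using a that twist_iff by (simp add: \<phi>_def inv_mult m_assoc[symmetric])
      (simp add: m_ac)
  have bij: "bij_betw \<phi> (carrier G) (carrier G)"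
    using phi_closed invol by (intro bij_betw_byWitness[where f' = \<phi>]) auto
  have step_a: "\<phi> (x \<otimes> s) \<in> {\<phi> x \<otimes> s, \<phi> x \<otimes> inv s}" if x: "x \<in> carrier G" and s: "s \<in> H" for x s
    using mult_iff[OF x s] x s a by (simp add: \<phi>_def inv_mult m_assoc)
  \<comment> \<open>Stated for any s with 2s = 2a that swaps the cosets, so as to serve both b and
    -b.\<close>
  have step_b: "\<phi> (x \<otimes> s) \<in> {\<phi> x \<otimes> s, \<phi> x \<otimes> inv s}"
    if x: "x \<in> carrier G" and s: "s \<in> carrier G" and ss: "s \<otimes> s = a \<otimes> a"
      and tog: "x \<otimes> s \<in> H \<longleftrightarrow> x \<notin> H" for x s
  proof (cases "x \<in> H")
    case True
    have "s \<otimes> s \<otimes> inv (x \<otimes> s) = s \<otimes> (s \<otimes> inv s \<otimes> inv x)"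
      using x s by (simp only: inv_mult_group m_assoc m_closed inv_closed)
    then have "\<phi> (x \<otimes> s) = s \<otimes> inv x" "\<phi> x = x"
      using True tog x s by (simp_all add: \<phi>_def flip: ss)
    moreover have "s \<otimes> inv x = x \<otimes> s" if "x \<otimes> x = \<one>"
      using that x s by (simp add: inv_equality m_comm)
    moreover have "s \<otimes> inv x = x \<otimes> inv s" if "x \<otimes> x = s \<otimes> s"
    proof -
      have "s \<otimes> inv x = (s \<otimes> s) \<otimes> inv s \<otimes> inv x" using x s by (simp add: m_assoc)
      also have "\<dots> = x \<otimes> inv s" unfolding that[symmetric]
      proof -
        have "x \<otimes> x \<otimes> inv s \<otimes> inv x = x \<otimes> inv s \<otimes> (x \<otimes> inv x)"
          using x s by (simp only: m_ac m_closed inv_closed)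
        then show "x \<otimes> x \<otimes> inv s \<otimes> inv x = x \<otimes> inv s" using x s by simp
      qed
      finally show ?thesis .
    qed
    ultimately show ?thesis using squares[OF x] ss by auto
  next
    case False
    then have eq: "\<phi> (x \<otimes> s) = x \<otimes> s" "\<phi> x = s \<otimes> s \<otimes> inv x"
      using tog x s by (simp_all add: \<phi>_def ss)
    have "x \<otimes> s = s \<otimes> s \<otimes> inv x \<otimes> s" if "x \<otimes> x = s \<otimes> s"
      unfolding that[symmetric] using x s by (simp add: m_assoc)
    moreover have "x \<otimes> s = s \<otimes> s \<otimes> inv x \<otimes> inv s" if "x \<otimes> x = \<one>"
    proof -
      have "inv x = x" using that x by (simp add: inv_equality)
      moreover have "s \<otimes> s \<otimes> x \<otimes> inv s = x \<otimes> s \<otimes> (s \<otimes> inv s)"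
        using x s by (simp only: m_ac m_closed inv_closed)
      ultimately show ?thesis using x s by simp
    qed
    ultimately show ?thesis using eq squares[OF x] ss by auto
  qed
  \<comment> \<open>-2b is nonzero, so \<open>squares\<close> leaves only the value 2a.\<close>
  have "inv b \<otimes> inv b = a \<otimes> a"
    using squares[of "inv b"] nontriv b sq inv_eq_1_iff[of "b \<otimes> b"] by (simp add: inv_mult)
  then have col: "\<phi> (x \<otimes> s) \<in> {\<phi> x \<otimes> s, \<phi> x \<otimes> inv s}" if "x \<in> carrier G" "s \<in> ?S" for x s
  proof -
    from that(2) consider "s \<in> H" | "s = b" | "s = inv b" using aH by auto
    then show ?thesis
    proof cases
      case 1
      then show ?thesis by (rule step_a[OF that(1)])
    next
      case 2
      then show ?thesis using step_b[OF that(1) b sq[symmetric] toggle[OF that(1)]] by simp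
    next
      case 3
      then show ?thesis
        using step_b[OF that(1) inv_closed[OF b] \<open>inv b \<otimes> inv b = a \<otimes> a\<close> toggle'[OF that(1)]] by simp
    qed
  qed
  have edge: "{u, v} \<in> snd (cay G ?S) \<longleftrightarrow> (\<exists>s\<in>?S. v = u \<otimes> s)"
    if "u \<in> carrier G" "v \<in> carrier G" for u v
    using a b that by (intro cay_edge_iff) auto
  \<comment> \<open>One direction suffices: \<phi> is an involution, so the converse follows by
    applying this to \<phi> u and \<phi> v.\<close>
  have fwd: "{\<phi> u, \<phi> v} \<in> snd (cay G ?S)"
    if u: "u \<in> carrier G" and v: "v \<in> carrier G" and uv: "{u, v} \<in> snd (cay G ?S)" for u v
  proof -
    obtain s where s: "s \<in> ?S" "v = u \<otimes> s"
      using uv edge[OF u v] by blast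
    have "inv s \<in> ?S" using s a b by auto
    then show ?thesis
      unfolding edge[OF phi_closed[OF u] phi_closed[OF v]] using col[OF u s(1)] s a b by auto
  qed
  have "graph_automorphism (cay G ?S) \<phi>"
    unfolding graph_automorphism_def
  proof (intro conjI ballI iffI)
    fix u v
    assume "u \<in> fst (cay G ?S)" "v \<in> fst (cay G ?S)" "{\<phi> u, \<phi> v} \<in> snd (cay G ?S)"
    then show "{u, v} \<in> snd (cay G ?S)"
      using fwd[of "\<phi> u" "\<phi> v"] invol phi_closed by (simp add: cay_def)
  qed (use bij fwd in \<open>auto simp: cay_def\<close>)
  moreover have "colour_preserving G ?S \<phi>"
    using col by (simp add: colour_preserving_def)
  moreover have "\<not> affine_bijection G \<phi>"
  proof
    assume "affine_bijection G \<phi>"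
    then obtain \<tau> c where \<tau>: "\<tau> \<in> iso G G" and c: "c \<in> carrier G"
      and eq: "\<And>x. x \<in> carrier G \<Longrightarrow> \<phi> x = \<tau> x \<otimes> c"
      by (auto simp: affine_bijection_def)
    have hom: "\<tau> \<in> hom G G" using \<tau> by (simp add: iso_def)
    \<comment> \<open>\<phi> fixes the identity, so an affine \<phi> would be a homomorphism.
      Additivity at a + b then reads b - a = b + a, against 2a being nonzero.\<close>
    have "c = \<one>"
      using eq[of \<one>] c hom_one[OF hom] is_group by (simp add: \<phi>_def)
    then have \<tau>_eq: "\<tau> x = \<phi> x" if "x \<in> carrier G" for x
      using eq[OF that] hom_in_carrier[OF hom that] by simp
    have "\<phi> (a \<otimes> b) = \<phi> a \<otimes> \<phi> b"
      using hom_mult[OF hom a b] a b by (simp add: \<tau>_eq)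
    moreover have "a \<otimes> b \<notin> H" using toggle[OF a] aH by simp
    moreover have "b \<notin> H" using notin by (simp add: H_def)
    ultimately have "b \<otimes> b \<otimes> inv (a \<otimes> b) = a \<otimes> (b \<otimes> b \<otimes> inv b)"
      using aH by (simp add: \<phi>_def sq)
    then have "b \<otimes> inv a = b \<otimes> a"
      using a b by (simp add: inv_mult m_ac)
    then have "inv a = a" using a b by simp
    then show False using nontriv a by (metis r_inv)
  qed
  ultimately show ?thesis by (auto simp: cca_def)
qed

end

section \<open>Doubling in Z_4 x Z_2, and the equivalence\<close>

lemma squares_Z4_Z2:
  fixes G (structure)
  defines "G \<equiv> integer_mod_group 4 \<times>\<times> integer_mod_group 2"
  assumes "x \<in> carrier G"
  shows "x \<otimes> x = \<one> \<or> x \<otimes> x = (2, 0)"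
proof -
  obtain i j where x: "x = (i, j)" by (cases x)
  then have "i \<in> {0, 1, 2, 3}"
    using assms by (auto simp: carrier_integer_mod_group)
  then show ?thesis using x by (auto simp: G_def DirProd_def)
qed

theorem corollary1p9:
  fixes G (structure) and a b :: 'a
  assumes "comm_group G"
    and "a \<in> carrier G" and "b \<in> carrier G" and "a \<noteq> b"
    and "generate G {a, b} = carrier G"
  shows "\<not> cca G {a, inv a, b, inv b} \<longleftrightarrow>
    G \<cong> (integer_mod_group 4 \<times>\<times> integer_mod_group 2) \<and> group.ord G a = 4 \<and> group.ord G b = 4"
proof
  interpret comm_group G by fact
  note a = assms(2) and b = assms(3) and gen = assms(5)
  assume "\<not> cca G {a, inv a, b, inv b}"
  then obtain \<phi> where "graph_automorphism (cay G {a, inv a, b, inv b}) \<phi>"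
    and col: "colour_preserving G {a, inv a, b, inv b} \<phi>" and naff: "\<not> affine_bijection G \<phi>"
    by (auto simp: cca_def)
  then have bij: "bij_betw \<phi> (carrier G) (carrier G)"
    by (simp add: graph_automorphism_def cay_def)
  \<comment> \<open>The hypotheses are symmetric in a and b, so the flip results also hold with the
    roles exchanged.\<close>
  have col': "colour_preserving G {b, inv b, a, inv a} \<phi>"
    using col by (auto simp: colour_preserving_def)
  note flip = colour_step_flip[OF bij a b col] and flip' = colour_step_flip[OF bij b a col']
  show "G \<cong> (integer_mod_group 4 \<times>\<times> integer_mod_group 2) \<and> ord a = 4 \<and> ord b = 4"
  proof (cases "(\<exists>g\<in>carrier G. colour_step G \<phi> a (g \<otimes> b) \<noteq> colour_step G \<phi> a g) \<or>
      (\<exists>g\<in>carrier G. colour_step G \<phi> b (g \<otimes> a) \<noteq> colour_step G \<phi> b g)")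
    case True
    then show ?thesis
    proof
      assume "\<exists>g\<in>carrier G. colour_step G \<phi> a (g \<otimes> b) \<noteq> colour_step G \<phi> a g"
      then obtain g where "g \<in> carrier G" "colour_step G \<phi> a (g \<otimes> b) \<noteq> colour_step G \<phi> a g"
        by blast
      note f = flip[OF this]
      have "ord a = 4" using f a by (intro ord_eq_4) auto
      moreover have "ord b = 4" using f b by (intro ord_eq_4) auto
      ultimately show ?thesis using f iso_Z4_Z2[OF a b gen] by blast
    next
      assume "\<exists>g\<in>carrier G. colour_step G \<phi> b (g \<otimes> a) \<noteq> colour_step G \<phi> b g"
      then obtain g where "g \<in> carrier G" "colour_step G \<phi> b (g \<otimes> a) \<noteq> colour_step G \<phi> b g"
        by blast
      note f = flip'[OF this]
      have "ord b = 4" using f b by (intro ord_eq_4) auto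
      moreover have "ord a = 4" using f a by (intro ord_eq_4) auto
      moreover have "generate G {b, a} = carrier G" using gen by (simp add: insert_commute)
      ultimately show ?thesis using f iso_Z4_Z2[OF b a] by blast
    qed
  next
    case False
    \<comment> \<open>A step changes neither across the other generator, by the case assumption, nor
      along its own, by \<open>colour_step_same\<close>; induction extends this to the whole
      group.\<close>
    have const: "colour_step G \<phi> s (x \<otimes> t) = colour_step G \<phi> s x"
      if "s \<in> {a, b}" "t \<in> {a, b}" "x \<in> carrier G" for s t x
      using False that colour_step_same[OF bij a b col] by auto
    have "\<forall>x\<in>carrier G. colour_step G \<phi> s (x \<otimes> y) = colour_step G \<phi> s x"
      if s: "s \<in> {a, b}" and "y \<in> generate G {a, b}" for s y
      using that(2)
    proof induction
      case (inv t)
      then have "t \<in> carrier G" using a b by auto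
      show ?case
      proof
        fix x assume "x \<in> carrier G"
        then show "colour_step G \<phi> s (x \<otimes> inv t) = colour_step G \<phi> s x"
          using const[OF s inv, of "x \<otimes> inv t"] \<open>t \<in> carrier G\<close> by (simp add: m_assoc)
      qed
    next
      case (eng y z)
      then have "y \<in> carrier G" "z \<in> carrier G" using gen by auto
      then show ?case using eng by (simp add: m_assoc[symmetric])
    qed (use const s in auto)
    then have "colour_step G \<phi> s x = colour_step G \<phi> s \<one>"
      if "s \<in> {a, b}" "x \<in> carrier G" for s x
      using that gen by (metis l_one one_closed)
    then have "affine_bijection G \<phi>"
      using a b gen bij by (intro affine_bijection_if_step_const) auto
    then show ?thesis using naff by contradiction
  qed
next
  interpret comm_group G by fact
  note a = assms(2) and b = assms(3) and gen = assms(5)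
  let ?Z = "integer_mod_group 4 \<times>\<times> integer_mod_group 2"
  assume asm: "G \<cong> ?Z \<and> ord a = 4 \<and> ord b = 4"
  then obtain h where h: "h \<in> iso G ?Z" by (auto simp: is_iso_def)
  have hom: "h \<in> hom G ?Z" and inj: "inj_on h (carrier G)"
    using h by (auto simp: iso_def bij_betw_def)
  have Z: "group ?Z" by (simp add: DirProd_group)
  have h_square: "x \<otimes> x = \<one> \<or> h (x \<otimes> x) = (2, 0)" if x: "x \<in> carrier G" for x
  proof -
    have "h (x \<otimes> x) = h \<one> \<or> h (x \<otimes> x) = (2, 0)"
      using squares_Z4_Z2[OF hom_in_carrier[OF hom x]] hom_mult[OF hom x x] hom_one[OF hom is_group Z]
      by simp
    then show ?thesis using inj x by (metis inj_onD m_closed one_closed)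
  qed
  have nontriv: "x \<otimes> x \<noteq> \<one>" if "x \<in> carrier G" "ord x = 4" for x
    using pow_eq_id[OF that(1), of 2] that nat_pow_Suc[of x 1]
    by (auto simp: numeral_2_eq_2[symmetric])
  \<comment> \<open>(2, 0) is the only nonzero double in Z_4 x Z_2. By injectivity of
    \<open>h\<close> all nonzero doubles in G agree, and 2a is one of them since a has order
    4.\<close>
  have squares: "x \<otimes> x = \<one> \<or> x \<otimes> x = a \<otimes> a" if x: "x \<in> carrier G" for x
    using h_square[OF x] h_square[OF a] nontriv[OF a] asm inj x a
    by (metis inj_onD m_closed)
  have sq: "a \<otimes> a = b \<otimes> b"
    using squares[OF b] nontriv[OF b] asm by auto
  \<comment> \<open>Otherwise a alone would generate G, which has 8 elements and not 4.\<close>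
  have "b \<notin> generate G {a}"
  proof
    assume "b \<in> generate G {a}"
    then have "{a, b} \<subseteq> generate G {a}" by (auto intro: generate.incl)
    then have "generate G {a, b} \<subseteq> generate G {a}"
      using a by (intro generate_subgroup_incl generate_is_subgroup) auto
    then have "carrier G = generate G {a}"
      using a gen generate_incl[of "{a}"] by auto
    then have "card (carrier G) = 4" using generate_pow_card[OF a] asm by simp
    moreover have "card (carrier G) = 8"
      using asm by (auto dest!: iso_same_card simp: carrier_integer_mod_group)
    ultimately show False by simp
  qed
  then show "\<not> cca G {a, inv a, b, inv b}"
    using not_cca_if_square_unique[OF a b gen sq _ _ squares] nontriv[OF a] asm by blast
qed

end
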